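(* Let $G$ be a group such that $[G:C_G(N)]<\infty$ for every minimal normal subgroup $N$ of $G$ contained in $\mathrm{T}(G)$. Let $K$ be a field and suppose that $G$ admits a faithful irreducible representation over $K$. Then $\mathrm{char}(K)\notin\Pi(G)$ and $\mathrm{T}(G)$ has a subgroup $S$ such that $\mathrm{T}(G)/S$ is locally cyclic and $\mathrm{core}_G(S)=1$.
   Context: Representations over $K$ are homomorphisms $G\to \mathrm{GL}(V)$ with $V$ a $K$-vector space of arbitrary (possibly infinite) dimension; irreducible means that $V\neq 0$ and $V$ has no invariant $K$-subspaces other than $0$ and $V$. $C_G(N)$ is the centralizer of $N$ in $G$. $\mathrm{T}(G)$ is the subgroup of $G$ generated by all minimal normal subgroups of $G$ that are torsion abelian. For a prime $p$, $\mathrm{T}(G)_p$ is the $p$-part of $\mathrm{T}(G)$, and $\Pi(G)$ is the set of all primes $p$ such that $\mathrm{T}(G)_p$ is non-trivial. $\mathrm{core}_G(S)=\bigcap_{g\in G} gSg^{-1}$ is the largest normal subgroup of $G$ contained in $S$. A group is locally cyclic if all its finitely generated subgroups are cyclic. *)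

theory Defs
  imports "HOL-Algebra.Algebra"
begin

subsection \<open>Torsion abelian minimal normal subgroups\<close>

definition torsion_group :: "('a, 'b) monoid_scheme \<Rightarrow> bool" where
  "torsion_group G \<longleftrightarrow> group G \<and> (\<forall>x\<in>carrier G. \<exists>n::nat. n > 0 \<and> x [^]\<^bsub>G\<^esub> n = \<one>\<^bsub>G\<^esub>)"

definition minimal_normal :: "'a set \<Rightarrow> ('a, 'b) monoid_scheme \<Rightarrow> bool" where
  "minimal_normal N G \<longleftrightarrow> N \<lhd> G \<and> N \<noteq> {\<one>\<^bsub>G\<^esub>} \<and>
     (\<forall>M. M \<lhd> G \<longrightarrow> M \<subseteq> N \<longrightarrow> M = {\<one>\<^bsub>G\<^esub>} \<or> M = N)"

definition torsion_socle :: "('a, 'b) monoid_scheme \<Rightarrow> 'a set" where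
  "torsion_socle G = generate G
     (\<Union>{N. minimal_normal N G \<and> comm_group (G\<lparr>carrier := N\<rparr>) \<and> torsion_group (G\<lparr>carrier := N\<rparr>)})"

text \<open>Used only for torsion abelian \<open>H\<close>, where this is the \<open>p\<close>-primary component.\<close>

definition p_part :: "('a, 'b) monoid_scheme \<Rightarrow> 'a set \<Rightarrow> nat \<Rightarrow> 'a set" where
  "p_part G H p = {x \<in> H. \<exists>k::nat. x [^]\<^bsub>G\<^esub> (p ^ k) = \<one>\<^bsub>G\<^esub>}"

text \<open>The qualified name is needed because \<^theory>\<open>HOL-Algebra.Divisibility\<close> also has a \<open>prime\<close>.\<close>

definition torsion_primes :: "('a, 'b) monoid_scheme \<Rightarrow> nat set" where
  "torsion_primes G = {p. Factorial_Ring.prime p \<and> p_part G (torsion_socle G) p \<noteq> {\<one>\<^bsub>G\<^esub>}}"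


subsection \<open>Centralizers, cores, locally cyclic groups\<close>

definition centralizer :: "('a, 'b) monoid_scheme \<Rightarrow> 'a set \<Rightarrow> 'a set" where
  "centralizer G N = {g \<in> carrier G. \<forall>x\<in>N. g \<otimes>\<^bsub>G\<^esub> x = x \<otimes>\<^bsub>G\<^esub> g}"

definition normal_core :: "('a, 'b) monoid_scheme \<Rightarrow> 'a set \<Rightarrow> 'a set" where
  "normal_core G S = (\<Inter>g\<in>carrier G. (g <#\<^bsub>G\<^esub> S) #>\<^bsub>G\<^esub> inv\<^bsub>G\<^esub> g)"

definition locally_cyclic :: "('a, 'b) monoid_scheme \<Rightarrow> bool" where
  "locally_cyclic G \<longleftrightarrow> group G \<and>
     (\<forall>A. finite A \<longrightarrow> A \<subseteq> carrier G \<longrightarrow> cyclic_group (subgroup_generated G A))"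


subsection \<open>Representations\<close>

text \<open>As \<^const>\<open>semiring_char\<close>, which is only available for type classes.\<close>

definition ring_char :: "('k, 'm) ring_scheme \<Rightarrow> nat" where
  "ring_char K = Gcd {n::nat. add_pow K n \<one>\<^bsub>K\<^esub> = \<zero>\<^bsub>K\<^esub>}"

text \<open>
  The group of invertible linear maps is a subgroup of \<^const>\<open>BijGroup\<close>, so its elements are
  extensional: they are \<^const>\<open>undefined\<close> outside the carrier of \<open>V\<close>.
\<close>

definition GL :: "('k, 'm) ring_scheme \<Rightarrow> ('k, 'v, 'n) module_scheme \<Rightarrow> ('v \<Rightarrow> 'v) monoid" where
  "GL K V = (BijGroup (carrier V))\<lparr>carrier :=
     {f \<in> Bij (carrier V).
        (\<forall>x\<in>carrier V. \<forall>y\<in>carrier V. f (x \<oplus>\<^bsub>V\<^esub> y) = f x \<oplus>\<^bsub>V\<^esub> f y) \<and>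
        (\<forall>a\<in>carrier K. \<forall>x\<in>carrier V. f (a \<odot>\<^bsub>V\<^esub> x) = a \<odot>\<^bsub>V\<^esub> f x)}\<rparr>"

definition representation ::
  "('a, 'b) monoid_scheme \<Rightarrow> ('k, 'm) ring_scheme \<Rightarrow> ('k, 'v, 'n) module_scheme \<Rightarrow> ('a \<Rightarrow> 'v \<Rightarrow> 'v) \<Rightarrow> bool"
where
  "representation G K V \<rho> \<longleftrightarrow> group G \<and> field K \<and> Module.module K V \<and> \<rho> \<in> hom G (GL K V)"

definition faithful_rep ::
  "('a, 'b) monoid_scheme \<Rightarrow> ('k, 'm) ring_scheme \<Rightarrow> ('k, 'v, 'n) module_scheme \<Rightarrow> ('a \<Rightarrow> 'v \<Rightarrow> 'v) \<Rightarrow> bool"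
where
  "faithful_rep G K V \<rho> \<longleftrightarrow> representation G K V \<rho> \<and> inj_on \<rho> (carrier G)"

definition irreducible_rep ::
  "('a, 'b) monoid_scheme \<Rightarrow> ('k, 'm) ring_scheme \<Rightarrow> ('k, 'v, 'n) module_scheme \<Rightarrow> ('a \<Rightarrow> 'v \<Rightarrow> 'v) \<Rightarrow> bool"
where
  "irreducible_rep G K V \<rho> \<longleftrightarrow> representation G K V \<rho> \<and> carrier V \<noteq> {\<zero>\<^bsub>V\<^esub>} \<and>
     (\<forall>W. submodule W K V \<longrightarrow> (\<forall>g\<in>carrier G. \<rho> g ` W \<subseteq> W) \<longrightarrow> W = {\<zero>\<^bsub>V\<^esub>} \<or> W = carrier V)"

end

theory Submission
  imports Defs
begin

text \<open>
  Let \<open>T\<close> be the torsion socle and let \<open>\<rho>\<close> be faithful and irreducible on \<open>V\<close>.  The argument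
  rests on three properties of \<open>T\<close>.  It is an abelian normal subgroup, because distinct minimal
  normal subgroups meet trivially and hence commute; it is torsion; and every element of it has only
  finitely many conjugates in \<open>G\<close>, because the elements with finitely many conjugates form a subgroup,
  which contains each generating minimal normal subgroup by the finite index hypothesis.

  A set \<open>C\<close> of elements of \<open>G\<close> that is closed under conjugation has a \<open>G\<close>-invariant space of common fixed
  vectors.  So if that space is non-zero, then it is all of \<open>V\<close>, and \<open>C\<close> is trivial by faithfulness
  (\<open>subset_one_if_common_fixed_vector\<close>).  The operators \<open>\<rho> t\<close> with \<open>t \<in> T\<close> and the scalars commute with
  each other, so they lie in a commutative ring \<open>A\<close> of additive endomorphisms of \<open>V\<close>.  Whenever some
  non-zero \<open>b \<in> A\<close> satisfies \<open>\<rho> x b = b\<close> for all \<open>x \<in> C\<close>, the image of \<open>b\<close> consists of fixed vectors and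
  \<open>C\<close> is trivial (\<open>subset_one_if_fixed_in_A\<close>).  Both claims follow by producing such a \<open>b\<close> for the
  conjugacy class \<open>C\<close> of an element of \<open>T\<close>.

  If \<open>q\<close> is the characteristic of \<open>K\<close> and \<open>x \<in> T\<close> satisfies \<open>x\<^sup>q = 1\<close>, then the operators \<open>\<rho> y - 1\<close> with \<open>y\<close>
  conjugate to \<open>x\<close> are nilpotent by the Frobenius identity, and finitely many nilpotents of a
  commutative ring have a common non-zero annihilator \<open>b\<close> (\<open>ex_annihilated_by_nilpotents\<close>).  Hence
  \<open>x = 1\<close>: the characteristic is not in \<open>\<Pi>(G)\<close>, and the orders of the elements of \<open>T\<close> are invertible in \<open>K\<close>.

  For the subgroup \<open>S\<close>, choose a maximal ideal \<open>M\<close> of \<open>A\<close>.  The residue map turns \<open>\<rho>\<close> into a homomorphism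
  from \<open>T\<close> to the multiplicative group of the field \<open>A / M\<close>; let \<open>S\<close> be its kernel.  Then \<open>T / S\<close> is a torsion
  group that embeds into the multiplicative group of a field, so it is locally cyclic
  (\<open>locally_cyclic_if_embeds_in_units\<close>).  If the conjugacy class \<open>C\<close> of some \<open>x \<in> T\<close> lies in \<open>S\<close>, then for
  \<open>y \<in> C\<close> of order \<open>n\<close> the geometric sum of the powers of \<open>\<rho> y\<close> below the \<open>n\<close>-th is fixed by \<open>\<rho> y\<close>, and it is
  congruent to \<open>n\<close> modulo \<open>M\<close>, hence not in \<open>M\<close>.  The product \<open>b\<close> of these sums over \<open>C\<close> is not in \<open>M\<close>
  either, so it is non-zero, and it is fixed by all of \<open>C\<close> (\<open>ex_fixed_not_in_primeideal\<close>).  Hence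
  \<open>x = 1\<close>, and the core of \<open>S\<close> is trivial.

  The maximal ideal replaces the choice of a one-dimensional constituent of the restriction of \<open>\<rho>\<close> to
  \<open>T\<close>, which need not exist when \<open>V\<close> has infinite dimension or \<open>K\<close> is not algebraically closed.
\<close>

section \<open>Torsion groups inside the multiplicative group of a field\<close>

lemma (in group) ord_mult_coprime:
  assumes "x \<in> carrier G" "y \<in> carrier G" "x \<otimes> y = y \<otimes> x" "coprime (ord x) (ord y)"
  shows "ord (x \<otimes> y) = ord x * ord y"
proof (rule dvd_antisym)
  show "ord (x \<otimes> y) dvd ord x * ord y"
    using assms by (intro ord_mul_divides)
  let ?t = "ord (x \<otimes> y)"
  have *: "ord a dvd ?t" if "a \<in> carrier G" "b \<in> carrier G" "a \<otimes> b = b \<otimes> a" "a \<otimes> b = x \<otimes> y"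
     "coprime (ord a) (ord b)" for a b
  proof -
    have "\<one> = (a \<otimes> b) [^] (?t * ord b)"
      using that by (metis m_closed nat_pow_one nat_pow_pow pow_ord_eq_1)
    also have "\<dots> = a [^] (?t * ord b) \<otimes> b [^] (?t * ord b)"
      by (rule pow_mult_distrib[OF that(3,1,2)])
    also have "b [^] (?t * ord b) = \<one>"
      using that by (simp add: pow_eq_id)
    finally have "a [^] (?t * ord b) = \<one>"
      using that by simp
    then have "ord a dvd ?t * ord b"
      using that by (simp only: pow_eq_id)
    then show ?thesis
      using that by (simp add: coprime_dvd_mult_left_iff)
  qed
  have "ord x dvd ?t" "ord y dvd ?t"
    using *[OF assms(1,2,3) refl assms(4)]
      *[OF assms(2,1) assms(3)[symmetric] assms(3)[symmetric]] assms(4)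
    by (blast, metis coprime_commute)
  then show "ord x * ord y dvd ?t"
    using assms(4) by (simp add: divides_mult)
qed

text \<open>
  The order of an element \<open>w\<close> of maximal order is already a multiple of all other orders: if a prime
  \<open>p\<close> divided the order of some \<open>y\<close> more often than that of \<open>w\<close>, then replacing the \<open>p\<close>-part of \<open>w\<close> by that
  of \<open>y\<close> would give an element of larger order.
\<close>

lemma (in comm_group) ex_ord_multiple_of_all_ord:
  assumes "N > 0" and exp: "\<And>x. x \<in> carrier G \<Longrightarrow> x [^] (N::nat) = \<one>"
  shows "\<exists>w\<in>carrier G. \<forall>y\<in>carrier G. ord y dvd ord w"
proof -
  have dvd: "ord x dvd N" if "x \<in> carrier G" for x
    using that exp by (simp add: pow_eq_id)
  then have le: "ord x \<le> N" if "x \<in> carrier G" for x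
    using that \<open>N > 0\<close> by (simp add: dvd_imp_le)
  have pos: "ord x > 0" if "x \<in> carrier G" for x
    using dvd[OF that] \<open>N > 0\<close> by (meson dvd_pos_nat)
  obtain w where w: "w \<in> carrier G" "\<And>y. y \<in> carrier G \<Longrightarrow> ord y \<le> ord w"
    using ex_has_greatest_nat[of "\<lambda>x. x \<in> carrier G" \<one> ord "Suc N"] le
    by (metis one_closed le_imp_less_Suc)
  have "ord y dvd ord w" if y: "y \<in> carrier G" for y
  proof (rule ccontr)
    assume ndvd: "\<not> ord y dvd ord w"
    then obtain p where p: "Factorial_Ring.prime p" "multiplicity p (ord w) < multiplicity p (ord y)"
      by (metis multiplicity_le_imp_dvd not_le pos[OF y] less_numeral_extra(3))
    define i j where "i = multiplicity p (ord w)" and "j = multiplicity p (ord y)"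
    obtain n where n: "ord w = p ^ i * n" "\<not> p dvd n"
      using multiplicity_decompose'[of "ord w" p] pos[OF w(1)] p(1) i_def
      by (metis less_numeral_extra(3) not_prime_unit)
    obtain m where m: "ord y = p ^ j * m" "\<not> p dvd m"
      using multiplicity_decompose'[of "ord y" p] pos[OF y] p(1) j_def
      by (metis less_numeral_extra(3) not_prime_unit)
    have p0: "p > 0" using p(1) prime_gt_0_nat by blast
    have m0: "m \<noteq> 0" using m pos[OF y] by (metis mult_0_right less_numeral_extra(3))
    have n0: "n > 0" using n(2) by (metis dvd_0_right gr0I)
    have "ord (w [^] (p ^ i)) = n"
      using ord_pow[OF w(1), of "p ^ i"] n p0 by simp
    moreover have "ord (y [^] m) = p ^ j"
      using ord_pow[OF y, of m] m m0 by simp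
    moreover have "coprime n (p ^ j)"
      using n(2) p(1) by (meson coprime_commute coprime_power_right_iff prime_imp_coprime_nat)
    ultimately have "ord (w [^] (p ^ i) \<otimes> y [^] m) = n * p ^ j"
      using ord_mult_coprime[of "w [^] (p ^ i)" "y [^] m"] w y by (simp add: m_comm)
    then have "n * p ^ j \<le> n * p ^ i"
      using w(2)[of "w [^] (p ^ i) \<otimes> y [^] m"] w(1) y n(1) by (simp add: mult.commute)
    then have "p ^ j \<le> p ^ i" using n0 by simp
    then have "j \<le> i"
      using prime_gt_1_nat[OF p(1)] power_le_imp_le_exp by blast
    then show False using p(2) i_def j_def by simp
  qed
  then show ?thesis using w(1) by blast
qed

lemma (in comm_group) finite_generate_bounded_exponent:
  assumes "finite A" "A \<subseteq> carrier G"
    and tors: "\<And>x. x \<in> A \<Longrightarrow> \<exists>n>0. x [^] (n::nat) = \<one>"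
  shows "\<exists>N>0. \<forall>x\<in>generate G A. x [^] (N::nat) = \<one>"
proof -
  have n: "ord x > 0" if "x \<in> A" for x
    using tors[OF that] that assms(2) by (metis gr0I ord_eq_0 subsetD)
  let ?N = "\<Prod>x\<in>A. ord x"
  have A: "x [^] ?N = \<one>" if "x \<in> A" for x
  proof -
    have "ord x dvd ?N" using that assms by (simp add: dvd_prodI)
    then show ?thesis using that assms(2)
      by (metis pow_eq_id subsetD)
  qed
  have "x [^] ?N = \<one>" if "x \<in> generate G A" for x
    using that
  proof induction
    case (inv h) then show ?case using A assms(2) by (metis nat_pow_inv inv_one subsetD)
  next
    case (eng h1 h2)
    then show ?case using generate_in_carrier[OF assms(2)] by (simp add: nat_pow_distrib)
  qed (use A in auto)
  moreover have "?N > 0" using n by (simp add: prod_pos)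
  ultimately show ?thesis by blast
qed

lemma (in field) roots_of_unity_card_le:
  assumes "n > 0"
  shows "finite {x \<in> carrier R. x [^] (n::nat) = \<one>}" (is "finite ?S")
    and "card {x \<in> carrier R. x [^] (n::nat) = \<one>} \<le> n"
proof -
  obtain k where n: "n = Suc k" using assms by (cases n) auto
  \<comment> \<open>the coefficient list of the polynomial \<open>X\<^sup>n - 1\<close>, leading coefficient first\<close>
  let ?p = "monom \<one> k @ [\<ominus> \<one>]"
  have p: "?p \<in> carrier (poly_ring R)"
    unfolding univ_poly_carrier[symmetric] polynomial_def by (auto simp: monom_def)
  have "eval ?p x = x [^] n \<ominus> \<one>" if "x \<in> carrier R" for x
    using that eval_append[of "monom \<one> k" "[\<ominus> \<one>]" x] eval_monom[of \<one> x k]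
    by (simp add: n monom_in_carrier minus_eq)
  then have "?S \<subseteq> set_mset (roots ?p)"
    using p by (auto simp: roots_mem_iff_is_root is_root_def r_neg minus_eq)
  moreover have "card (set_mset (roots ?p)) \<le> n"
  proof -
    have "card (set_mset M) \<le> size M" for M :: "'a multiset"
      by (induction M) (auto simp: card_insert_if)
    from this[of "roots ?p"] show ?thesis
      using size_roots_le_degree[OF p] by (simp add: n monom_def)
  qed
  ultimately show "finite ?S" "card ?S \<le> n"
    by (auto intro: finite_subset le_trans[OF card_mono])
qed

text \<open>
  A finitely generated subgroup of \<open>Q\<close> has bounded exponent, so it contains an element \<open>w\<close> whose order \<open>n\<close>
  is a multiple of all orders.  Its image in the field then consists of \<open>n\<close>-th roots of unity, of which
  there are at most \<open>n\<close>, and the \<open>n\<close> powers of \<open>w\<close> exhaust them.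
\<close>

lemma (in field) locally_cyclic_if_embeds_in_units:
  assumes "group Q" and hom: "\<psi> \<in> hom Q (units_of R)" and inj: "inj_on \<psi> (carrier Q)"
    and tors: "\<And>x. x \<in> carrier Q \<Longrightarrow> \<exists>n>0. x [^]\<^bsub>Q\<^esub> (n::nat) = \<one>\<^bsub>Q\<^esub>"
  shows "locally_cyclic Q"
proof -
  interpret Q: group Q by fact
  interpret M: group "units_of R" by (rule units_group)
  interpret \<psi>: group_hom Q "units_of R" \<psi>
    using hom by unfold_locales
  interpret Q: comm_group Q
  proof (rule Q.group_comm_groupI)
    fix x y assume xy: "x \<in> carrier Q" "y \<in> carrier Q"
    then have "\<psi> x \<in> carrier R" "\<psi> y \<in> carrier R"
      using \<psi>.hom_closed by (auto simp: units_of_carrier)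
    then have "\<psi> (x \<otimes>\<^bsub>Q\<^esub> y) = \<psi> (y \<otimes>\<^bsub>Q\<^esub> x)"
      using xy by (simp add: units_of_mult m_comm)
    then show "x \<otimes>\<^bsub>Q\<^esub> y = y \<otimes>\<^bsub>Q\<^esub> x"
      using inj xy by (meson Q.m_closed inj_onD)
  qed
  have "cyclic_group (subgroup_generated Q A)" if A: "finite A" "A \<subseteq> carrier Q" for A
  proof -
    let ?H = "subgroup_generated Q A"
    have H: "carrier ?H = generate Q A"
      using A by (simp add: carrier_subgroup_generated Int_absorb1)
    have sub: "carrier ?H \<subseteq> carrier Q"
      by (rule Q.carrier_subgroup_generated_subset)
    have pow: "x [^]\<^bsub>?H\<^esub> n = x [^]\<^bsub>Q\<^esub> n" for x and n :: nat
      by (simp add: pow_subgroup_generated)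
    interpret H: comm_group ?H
      using Q.comm_group_axioms by (rule Q.abelian_subgroup_generated)
    have "\<exists>N>0. \<forall>x\<in>generate Q A. x [^]\<^bsub>Q\<^esub> (N::nat) = \<one>\<^bsub>Q\<^esub>"
      using Q.finite_generate_bounded_exponent[OF A] tors A(2) by blast
    then obtain N where N: "N > 0" "\<And>x. x \<in> carrier ?H \<Longrightarrow> x [^]\<^bsub>?H\<^esub> (N::nat) = \<one>\<^bsub>?H\<^esub>"
      unfolding H pow one_subgroup_generated by blast
    obtain w where w: "w \<in> carrier ?H" "\<And>y. y \<in> carrier ?H \<Longrightarrow> H.ord y dvd H.ord w"
      using H.ex_ord_multiple_of_all_ord[OF N(1) N(2)] by auto
    define n where "n = H.ord w"
    have "n dvd N"
      using N w(1) by (simp add: n_def flip: H.pow_eq_id)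
    then have "n > 0" using N(1) by (rule dvd_pos_nat[rotated])
    have *: "y [^]\<^bsub>?H\<^esub> n = \<one>\<^bsub>?H\<^esub>" if "y \<in> carrier ?H" for y
      using w(2)[OF that] H.pow_eq_id[OF that] unfolding n_def by blast
    let ?S = "{z \<in> carrier R. z [^] n = \<one>}"
    have sub': "\<psi> ` carrier ?H \<subseteq> ?S"
    proof safe
      fix y assume y: "y \<in> carrier ?H"
      then have yQ: "y \<in> carrier Q" using sub by blast
      then show "\<psi> y \<in> carrier R" using \<psi>.hom_closed by (auto simp: units_of_carrier)
      have "\<psi> y [^]\<^bsub>units_of R\<^esub> n = \<psi> (y [^]\<^bsub>Q\<^esub> n)"
        using yQ by (simp add: \<psi>.hom_nat_pow)
      also have "y [^]\<^bsub>Q\<^esub> n = \<one>\<^bsub>Q\<^esub>"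
        using *[OF y] pow by simp
      finally show "\<psi> y [^] n = \<one>"
        by (simp add: units_of_def nat_pow_def)
    qed
    have inj': "inj_on \<psi> (carrier ?H)"
      using inj sub by (rule inj_on_subset)
    have fin: "finite (carrier ?H)"
      using finite_imageD[OF finite_subset[OF sub' roots_of_unity_card_le(1)[OF \<open>n > 0\<close>]] inj'] .
    have "card (carrier ?H) \<le> n"
      using card_inj_on_le[OF inj' sub' roots_of_unity_card_le(1)[OF \<open>n > 0\<close>]]
        roots_of_unity_card_le(2)[OF \<open>n > 0\<close>] by linarith
    moreover have "card ((\<lambda>i. w [^]\<^bsub>?H\<^esub> i) ` {0..n - 1}) = n"
      using card_image[OF H.ord_inj[OF w(1)]] \<open>n > 0\<close> by (simp add: n_def)
    moreover have "(\<lambda>i. w [^]\<^bsub>?H\<^esub> i) ` {0..n - 1} \<subseteq> carrier ?H"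
      using w(1) by auto
    ultimately have "carrier ?H = (\<lambda>i. w [^]\<^bsub>?H\<^esub> i) ` {0..n - 1}"
      using fin by (metis card_seteq)
    also have "\<dots> \<subseteq> range (\<lambda>i::int. w [^]\<^bsub>?H\<^esub> i)"
      by (intro image_subsetI range_eqI) (rule int_pow_int[symmetric])
    finally have "carrier ?H = range (\<lambda>i::int. w [^]\<^bsub>?H\<^esub> i)"
      using w(1) by auto
    then show ?thesis
      using w(1) H.cyclic_group by blast
  qed
  then show ?thesis
    unfolding locally_cyclic_def using \<open>group Q\<close> by blast
qed

section \<open>Ideals, nilpotents and roots of unity in commutative rings\<close>

lemma (in ring) ex_maximalideal:
  assumes "\<one> \<noteq> \<zero>"
  shows "\<exists>M. maximalideal M R"
proof -
  let ?I = "{I. ideal I R \<and> \<one> \<notin> I}"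
  have "\<exists>M\<in>?I. \<forall>J\<in>?I. M \<subseteq> J \<longrightarrow> J = M"
  proof (rule subset_Zorn)
    fix C assume C: "subset.chain ?I C"
    show "\<exists>U\<in>?I. \<forall>J\<in>C. J \<subseteq> U"
    proof (cases "C = {}")
      case True
      then show ?thesis using zeroideal assms by auto
    next
      case False
      have "subset.chain {I. ideal I R} C"
        using C unfolding pred_on.chain_def by auto
      then have "ideal (\<Union>C) R"
        using chain_Union_is_ideal[of C] False by simp
      moreover have "\<one> \<notin> \<Union>C"
        using C unfolding pred_on.chain_def by auto
      ultimately show ?thesis by blast
    qed
  qed
  then obtain M where M: "ideal M R" "\<one> \<notin> M"
    and max: "\<And>J. ideal J R \<Longrightarrow> \<one> \<notin> J \<Longrightarrow> M \<subseteq> J \<Longrightarrow> J = M"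
    by blast
  have "maximalideal M R"
  proof (rule maximalidealI)
    show "carrier R \<noteq> M" using M(2) by auto
    fix J assume "ideal J R" "M \<subseteq> J" "J \<subseteq> carrier R"
    then show "J = M \<or> J = carrier R"
      using max ideal.one_imp_carrier by blast
  qed (rule M(1))
  then show ?thesis by blast
qed

lemma (in cring) binomial:
  assumes a: "a \<in> carrier R"
  shows "(\<one> \<oplus> a) [^] n = (\<Oplus>k\<in>{..n}. add_pow R (n choose k) (a [^] k))"
proof (induction n)
  case 0
  show ?case by (simp add: a)
next
  case (Suc n)
  let ?t = "\<lambda>n k. add_pow R (n choose k) (a [^] k)"
  have t: "?t n k \<in> carrier R" for n k using a by simp
  have shift: "(\<Oplus>k\<in>{..n}. ?t n k) = (\<Oplus>k\<in>{..n}. ?t n (Suc k)) \<oplus> ?t n 0"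
  proof -
    have "(\<Oplus>k\<in>{..n}. ?t n k) = (\<Oplus>k\<in>{..Suc n}. ?t n k)"
      using t by (subst finsum_Suc) (auto simp: binomial_eq_0)
    also have "\<dots> = (\<Oplus>k\<in>{..n}. ?t n (Suc k)) \<oplus> ?t n 0"
      using t by (subst finsum_Suc2) auto
    finally show ?thesis .
  qed
  have times_a: "(\<Oplus>k\<in>{..n}. ?t n k) \<otimes> a = (\<Oplus>k\<in>{..n}. add_pow R (n choose k) (a [^] Suc k))"
    using a by (subst finsum_ldistr) (auto simp: add_pow_ldistr intro!: finsum_cong')
  have "(\<one> \<oplus> a) [^] Suc n = (\<Oplus>k\<in>{..n}. ?t n k) \<oplus> (\<Oplus>k\<in>{..n}. ?t n k) \<otimes> a"
    using a Suc by (simp add: r_distr)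
  also have "\<dots> = (\<Oplus>k\<in>{..n}. ?t n (Suc k)) \<oplus> ?t n 0 \<oplus> (\<Oplus>k\<in>{..n}. add_pow R (n choose k) (a [^] Suc k))"
    unfolding times_a unfolding shift ..
  also have "\<dots> = (\<Oplus>k\<in>{..n}. ?t n (Suc k) \<oplus> add_pow R (n choose k) (a [^] Suc k)) \<oplus> ?t n 0"
    using a by (subst finsum_addf) (auto simp: a_ac)
  also have "(\<Oplus>k\<in>{..n}. ?t n (Suc k) \<oplus> add_pow R (n choose k) (a [^] Suc k))
     = (\<Oplus>k\<in>{..n}. ?t (Suc n) (Suc k))"
    using a by (intro finsum_cong') (auto simp: add.nat_pow_mult a_comm)
  also have "\<dots> \<oplus> ?t n 0 = (\<Oplus>k\<in>{..Suc n}. ?t (Suc n) k)"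
    using t by (subst finsum_Suc2) auto
  finally show ?case .
qed

text \<open>
  The inner binomial coefficients are divisible by \<open>p\<close>.
\<close>

lemma (in cring) one_plus_pow_prime_char:
  assumes a: "a \<in> carrier R" and p: "Factorial_Ring.prime p" "add_pow R (p::nat) \<one> = \<zero>"
  shows "(\<one> \<oplus> a) [^] p = \<one> \<oplus> a [^] p"
proof -
  obtain n where n: "p = Suc (Suc n)"
    using prime_ge_2_nat[OF p(1)] by (metis add_2_eq_Suc le_Suc_ex)
  define f where "f k = add_pow R (p choose k) (a [^] k)" for k
  have t: "f k \<in> carrier R" for k using a by (simp add: f_def)
  have 0: "f (Suc k) = \<zero>" if k: "k \<le> n" for k
  proof -
    have "p dvd (p choose Suc k)"
      using k by (intro dvd_choose_prime p(1)) (auto simp: n)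
    then obtain m where m: "p choose Suc k = p * m" ..
    have "add_pow R (p * m) (a [^] Suc k) = add_pow R m (add_pow R p (a [^] Suc k))"
      using a by (subst add.nat_pow_pow) auto
    also have "add_pow R p (a [^] Suc k) = add_pow R p \<one> \<otimes> (a [^] Suc k)"
      using a by (subst add_pow_ldistr) auto
    finally show ?thesis using a by (simp add: f_def m p(2))
  qed
  have "(\<one> \<oplus> a) [^] p = (\<Oplus>k\<in>{..p}. f k)"
    unfolding f_def by (rule binomial[OF a])
  also have "\<dots> = f p \<oplus> (\<Oplus>k\<in>{..Suc n}. f k)"
    unfolding n using t by (intro finsum_Suc) auto
  also have "(\<Oplus>k\<in>{..Suc n}. f k) = (\<Oplus>k\<in>{..n}. f (Suc k)) \<oplus> f 0"
    using t by (intro finsum_Suc2) auto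
  also have "(\<Oplus>k\<in>{..n}. f (Suc k)) = (\<Oplus>k\<in>{..n}. \<zero>)"
    using 0 by (intro finsum_cong') auto
  finally show ?thesis using a by (simp add: f_def a_comm)
qed

lemma (in cring) nilpotent_minus_one:
  assumes x: "x \<in> carrier R" "x [^] (p::nat) = \<one>" and p: "Factorial_Ring.prime p" "add_pow R p \<one> = \<zero>"
  shows "(x \<ominus> \<one>) [^] p = \<zero>"
proof -
  have "\<one> \<oplus> (x \<ominus> \<one>) = x" using x by algebra
  then have "\<one> \<oplus> (x \<ominus> \<one>) [^] p = \<one>"
    using one_plus_pow_prime_char[of "x \<ominus> \<one>" p] x p by simp
  then show ?thesis using x by (simp add: add.r_cancel_one')
qed

text \<open>
  Nilpotents are added one at a time: if \<open>b\<close> is annihilated by the earlier ones, then so is every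
  multiple of \<open>b\<close>, and the last non-zero one among the products \<open>x\<^sup>k b\<close> is annihilated by the new
  nilpotent \<open>x\<close> as well.
\<close>

lemma (in cring) ex_annihilated_by_nilpotents:
  assumes "\<one> \<noteq> \<zero>" "finite A" "A \<subseteq> carrier R" "\<And>x. x \<in> A \<Longrightarrow> \<exists>n. x [^] (n::nat) = \<zero>"
  shows "\<exists>b\<in>carrier R. b \<noteq> \<zero> \<and> (\<forall>x\<in>A. x \<otimes> b = \<zero>)"
  using assms(2-4)
proof (induction A)
  case empty
  then show ?case using assms(1) by auto
next
  case (insert x A)
  then obtain b where b: "b \<in> carrier R" "b \<noteq> \<zero>" "\<And>y. y \<in> A \<Longrightarrow> y \<otimes> b = \<zero>"
    by auto
  have x: "x \<in> carrier R" using insert by simp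
  obtain n where n: "x [^] (n::nat) = \<zero>" using insert.prems by auto
  define k where "k = (LEAST k::nat. x [^] k \<otimes> b = \<zero>)"
  have "x [^] n \<otimes> b = \<zero>" using n b by simp
  then have k: "x [^] k \<otimes> b = \<zero>" unfolding k_def by (rule LeastI)
  then have "k \<noteq> 0" using b by (metis l_one nat_pow_0)
  then obtain j where j: "k = Suc j" by (cases k) auto
  have "x [^] j \<otimes> b \<noteq> \<zero>"
    using not_less_Least[of j "\<lambda>k. x [^] k \<otimes> b = \<zero>"] j k_def by auto
  moreover have "x \<otimes> (x [^] j \<otimes> b) = \<zero>"
    using k x b(1) j m_assoc[of x "x [^] j" b] m_comm[of x "x [^] j"] by simp
  moreover have "y \<otimes> (x [^] j \<otimes> b) = \<zero>" if "y \<in> A" for y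
    using b(1) b(3)[OF that] that x insert.prems m_lcomm[of y "x [^] j" b] by auto
  ultimately show ?case using x b by (intro bexI[of _ "x [^] j \<otimes> b"]) auto
qed

text \<open>
  An averaging argument without division.  Modulo \<open>I\<close> every \<open>x\<close> in the set is \<open>1\<close>, so the sum \<open>e\<close> of the
  powers of \<open>x\<close> below the \<open>n\<close>-th is \<open>n\<close> modulo \<open>I\<close> and does not lie in \<open>I\<close>; since \<open>x\<^sup>n = 1\<close>,
  multiplication by \<open>x\<close> permutes the summands.  As \<open>I\<close> is prime, the product of these sums over all \<open>x\<close>
  avoids \<open>I\<close>, too.
\<close>

lemma (in cring) ex_fixed_not_in_primeideal:
  assumes "primeideal I R" "finite A" "A \<subseteq> carrier R"
    and A: "\<And>x. x \<in> A \<Longrightarrow> x \<ominus> \<one> \<in> I \<and> (\<exists>n. x [^] (n::nat) = \<one> \<and> add_pow R n \<one> \<notin> I)"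
  shows "\<exists>b\<in>carrier R. b \<notin> I \<and> (\<forall>x\<in>A. x \<otimes> b = b)"
proof -
  interpret primeideal I R by fact
  \<comment> \<open>\<open>e\<close> is the geometric sum of length \<open>n\<close>; the equation is \<open>(x - 1) e = x\<^sup>n - 1\<close>\<close>
  have geom: "\<exists>e\<in>carrier R. x \<otimes> e \<oplus> \<one> = e \<oplus> x [^] n \<and> e \<ominus> add_pow R n \<one> \<in> I"
    if x: "x \<in> carrier R" "x \<ominus> \<one> \<in> I" for x and n :: nat
  proof -
    have *: "y \<otimes> x \<ominus> \<one> = (y \<ominus> \<one>) \<otimes> x \<oplus> (x \<ominus> \<one>)" if "y \<in> carrier R" for y
      using that x(1) by algebra
    have **: "(a \<oplus> b) \<ominus> (c \<oplus> \<one>) = (a \<ominus> c) \<oplus> (b \<ominus> \<one>)"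
      if "a \<in> carrier R" "b \<in> carrier R" "c \<in> carrier R" for a b c
      using that by algebra
    have xI: "x [^] n \<ominus> \<one> \<in> I" for n :: nat
    proof (induction n)
      case 0 then show ?case by (simp add: minus_eq r_neg)
    next
      case (Suc n)
      have "x [^] Suc n \<ominus> \<one> = (x [^] n \<ominus> \<one>) \<otimes> x \<oplus> (x \<ominus> \<one>)"
        using *[OF nat_pow_closed[OF x(1), of n]] by simp
      then show ?case using Suc x I_r_closed a_closed by metis
    qed
    show ?thesis
    proof (induction n)
      case 0 show ?case using x by (intro bexI[of _ \<zero>]) (auto simp: minus_eq)
    next
      case (Suc n)
      then obtain e where e: "e \<in> carrier R" "x \<otimes> e \<oplus> \<one> = e \<oplus> x [^] n" "e \<ominus> add_pow R n \<one> \<in> I"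
        by blast
      have xn: "x [^] n \<in> carrier R" "add_pow R n \<one> \<in> carrier R" using x by auto
      have "x \<otimes> (e \<oplus> x [^] n) \<oplus> \<one> = (x \<otimes> e \<oplus> \<one>) \<oplus> x [^] n \<otimes> x"
        using x e(1) xn by algebra
      then have "x \<otimes> (e \<oplus> x [^] n) \<oplus> \<one> = (e \<oplus> x [^] n) \<oplus> x [^] Suc n"
        using e(2) by simp
      moreover have "(e \<oplus> x [^] n) \<ominus> add_pow R (Suc n) \<one> = (e \<ominus> add_pow R n \<one>) \<oplus> (x [^] n \<ominus> \<one>)"
        using **[OF e(1) xn] by simp
      then have "(e \<oplus> x [^] n) \<ominus> add_pow R (Suc n) \<one> \<in> I"
        using e(3) xI a_closed by metis
      ultimately show ?case using e(1) x by blast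
    qed
  qed
  show ?thesis
    using assms(2,3) A
  proof (induction A)
    case empty
    have "\<one> \<notin> I" using one_imp_carrier I_notcarr by blast
    then show ?case by auto
  next
    case (insert x A)
    then obtain b where b: "b \<in> carrier R" "b \<notin> I" "\<And>y. y \<in> A \<Longrightarrow> y \<otimes> b = b"
      by auto
    have x: "x \<in> carrier R" "x \<ominus> \<one> \<in> I" using insert.prems by auto
    obtain n where n: "x [^] (n::nat) = \<one>" "add_pow R n \<one> \<notin> I" using insert.prems by auto
    obtain e where e: "e \<in> carrier R" "x \<otimes> e \<oplus> \<one> = e \<oplus> \<one>" "e \<ominus> add_pow R n \<one> \<in> I"
      using geom[OF x, of n] n(1) by auto
    have xe: "x \<otimes> e = e" using e(1,2) x by (metis m_closed one_closed add.right_cancel)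
    have "e \<notin> I"
    proof
      assume "e \<in> I"
      then have "e \<oplus> \<ominus> (e \<ominus> add_pow R n \<one>) \<in> I" using e(3) by (intro a_closed a_inv_closed)
      moreover have "e \<oplus> \<ominus> (e \<ominus> add_pow R n \<one>) = add_pow R n \<one>"
        using e(1) add.nat_pow_closed[OF one_closed, of n] by algebra
      ultimately show False using n(2) by simp
    qed
    then have "e \<otimes> b \<notin> I" using I_prime e(1) b by blast
    moreover have "x \<otimes> (e \<otimes> b) = e \<otimes> b"
      using xe x e(1) b(1) by (metis m_assoc)
    moreover have "y \<otimes> (e \<otimes> b) = e \<otimes> b" if "y \<in> A" for y
      using b(1) b(3)[OF that] that e(1) insert.prems m_lcomm[of y e b] by auto
    ultimately show ?case using e(1) b(1) by (intro bexI[of _ "e \<otimes> b"]) auto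
  qed
qed

section \<open>The characteristic of a domain\<close>

lemma (in domain) ex_prime_dvd_add_pow_eq_zero:
  assumes "n > 0" "add_pow R (n::nat) \<one> = \<zero>"
  shows "\<exists>q. Factorial_Ring.prime q \<and> q dvd n \<and> add_pow R q \<one> = \<zero>"
  using assms
proof (induction n rule: less_induct)
  case (less n)
  then have "n \<noteq> 1" by auto
  then obtain q where q: "Factorial_Ring.prime q" "q dvd n" using prime_factor_nat by blast
  then obtain m where m: "n = q * m" by blast
  have "add_pow R q \<one> \<otimes> add_pow R m \<one> = add_pow R n \<one>"
    by (simp add: m add_pow_ldistr add_pow_rdistr add.nat_pow_pow mult.commute)
  then consider "add_pow R q \<one> = \<zero>" | "add_pow R m \<one> = \<zero>"
    using less.prems by (metis add.nat_pow_closed one_closed integral)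
  then show ?case
  proof cases
    case 2
    have "m < n" "m > 0" using m less.prems(1) prime_gt_1_nat[OF q(1)] by auto
    then show ?thesis using less.IH[OF _ _ 2] m by (metis dvd_mult)
  qed (use q in auto)
qed

text \<open>
  A prime greatest common divisor of the annihilators of \<open>1\<close> forces one of them to be positive, and in a
  domain some prime \<open>q\<close> then annihilates \<open>1\<close>; a prime that divides the prime \<open>q\<close> is equal to it.
\<close>

lemma (in domain) ring_char_prime_imp:
  assumes "Factorial_Ring.prime (ring_char R)"
  shows "add_pow R (ring_char R) \<one> = \<zero>"
proof -
  let ?D = "{n::nat. add_pow R n \<one> = \<zero>}"
  have "\<not> ?D \<subseteq> {0}"
  proof
    assume "?D \<subseteq> {0}"
    then have "ring_char R = 0" unfolding ring_char_def by simp
    then show False using assms by simp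
  qed
  then obtain n :: nat where "n > 0" "add_pow R n \<one> = \<zero>" by auto
  from ex_prime_dvd_add_pow_eq_zero[OF this]
  obtain q :: nat where q: "Factorial_Ring.prime q" "add_pow R q \<one> = \<zero>"
    by blast
  have "ring_char R dvd q" unfolding ring_char_def by (rule Gcd_dvd) (simp add: q(2))
  then have "ring_char R = q" by (rule primes_dvd_imp_eq[OF assms q(1)])
  then show ?thesis using q(2) by simp
qed

section \<open>Commutants and additive endomorphisms\<close>

definition commutant :: "('a, 'b) ring_scheme \<Rightarrow> 'a set \<Rightarrow> 'a set" where
  "commutant R A = {a \<in> carrier R. \<forall>x\<in>A. a \<otimes>\<^bsub>R\<^esub> x = x \<otimes>\<^bsub>R\<^esub> a}"

lemma (in ring) subring_commutant:
  assumes "A \<subseteq> carrier R"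
  shows "subring (commutant R A) R"
  using assms
  by (intro subringI)
    (auto simp: commutant_def l_minus r_minus l_distr r_distr subset_iff, metis m_assoc)

text \<open>
  The double commutant gives a commutative subring around a commuting set without describing the
  elements that the set generates: the set lies in its commutant, so the double commutant lies in the
  commutant, and the elements of the one commute with those of the other.
\<close>

lemma (in ring) subcring_bicommutant:
  assumes A: "A \<subseteq> carrier R" and comm: "\<And>x y. x \<in> A \<Longrightarrow> y \<in> A \<Longrightarrow> x \<otimes> y = y \<otimes> x"
  shows "subcring (commutant R (commutant R A)) R" and "A \<subseteq> commutant R (commutant R A)"
proof -
  have sub: "commutant R A \<subseteq> carrier R" by (auto simp: commutant_def)
  show A': "A \<subseteq> commutant R (commutant R A)"
    using A by (auto simp: commutant_def)
  show "subcring (commutant R (commutant R A)) R"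
  proof (rule subcringI)
    show "subring (commutant R (commutant R A)) R"
      using sub by (rule subring_commutant)
    have "A \<subseteq> commutant R A"
      using A comm by (auto simp: commutant_def)
    then have "commutant R (commutant R A) \<subseteq> commutant R A"
      unfolding commutant_def by blast
    then show "a \<otimes> b = b \<otimes> a"
      if "a \<in> commutant R (commutant R A)" "b \<in> commutant R (commutant R A)" for a b
      using that unfolding commutant_def by blast
  qed
qed

text \<open>
  The endomorphisms are extensional functions, in agreement with \<^const>\<open>BijGroup\<close>, so that equal
  operators are equal as functions and the values of a representation are elements of this ring.
\<close>

definition additive_endos :: "('v, 'n) ring_scheme \<Rightarrow> ('v \<Rightarrow> 'v) ring" where
  "additive_endos V =
    \<lparr>partial_object.carrier = {f \<in> carrier V \<rightarrow>\<^sub>E carrier V.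
       \<forall>x\<in>carrier V. \<forall>y\<in>carrier V. f (x \<oplus>\<^bsub>V\<^esub> y) = f x \<oplus>\<^bsub>V\<^esub> f y},
     monoid.mult = compose (carrier V), monoid.one = (\<lambda>x\<in>carrier V. x),
     ring.zero = (\<lambda>x\<in>carrier V. \<zero>\<^bsub>V\<^esub>), ring.add = (\<lambda>f g. \<lambda>x\<in>carrier V. f x \<oplus>\<^bsub>V\<^esub> g x)\<rparr>"

lemma (in abelian_group) ring_additive_endos: "ring (additive_endos G)"
proof (rule ringI)
  show "abelian_group (additive_endos G)"
  proof (rule abelian_groupI)
    fix f assume f: "f \<in> carrier (additive_endos G)"
    have "(\<lambda>x\<in>carrier G. \<ominus> f x) \<in> carrier (additive_endos G)"
      using f by (auto simp: additive_endos_def PiE_iff minus_add)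
    moreover have "(\<lambda>x\<in>carrier G. \<ominus> f x) \<oplus>\<^bsub>additive_endos G\<^esub> f = \<zero>\<^bsub>additive_endos G\<^esub>"
      using f by (auto simp: additive_endos_def PiE_iff l_neg)
    ultimately show "\<exists>g\<in>carrier (additive_endos G). g \<oplus>\<^bsub>additive_endos G\<^esub> f = \<zero>\<^bsub>additive_endos G\<^esub>"
      by blast
  qed (auto simp: additive_endos_def PiE_iff extensional_def a_ac intro!: ext)
  show "monoid (additive_endos G)"
    by (rule monoidI)
      (auto simp: additive_endos_def PiE_iff compose_def extensional_def intro!: ext)
qed (auto simp: additive_endos_def PiE_iff compose_def extensional_def intro!: ext)

section \<open>Finite conjugacy classes and the torsion socle\<close>

text \<open>
  The commutator of \<open>x\<close> and \<open>y\<close> lies in both normal subgroups.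
\<close>

lemma (in group) normal_Int_trivial_imp_commute:
  assumes "N \<lhd> G" "M \<lhd> G" "N \<inter> M = {\<one>}" "x \<in> N" "y \<in> M"
  shows "x \<otimes> y = y \<otimes> x"
proof -
  interpret N: normal N G by fact
  interpret M: normal M G by fact
  have xy: "x \<in> carrier G" "y \<in> carrier G" using assms by auto
  have "x \<otimes> y \<otimes> inv x \<otimes> inv y = (x \<otimes> y \<otimes> inv x) \<otimes> inv y" by simp
  moreover have "\<dots> \<in> M"
    using M.inv_op_closed2[OF xy(1) assms(5)] assms(5) by (simp add: M.m_closed)
  moreover have "x \<otimes> y \<otimes> inv x \<otimes> inv y = x \<otimes> (y \<otimes> inv x \<otimes> inv y)"
    using xy by (simp add: m_assoc)
  moreover have "\<dots> \<in> N"
    using N.inv_op_closed2[OF xy(2), of "inv x"] assms(4) by (simp add: N.m_closed)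
  ultimately have "x \<otimes> y \<otimes> inv x \<otimes> inv y = \<one>"
    using assms(3) by auto
  then have "(x \<otimes> y) \<otimes> inv (y \<otimes> x) = \<one>"
    using xy by (simp add: inv_mult_group m_assoc)
  then show ?thesis
    using xy by (metis inv_closed inv_equality inv_inv m_closed)
qed

definition conjugates :: "('a, 'b) monoid_scheme \<Rightarrow> 'a \<Rightarrow> 'a set" where
  "conjugates G x = (\<lambda>g. inv\<^bsub>G\<^esub> g \<otimes>\<^bsub>G\<^esub> x \<otimes>\<^bsub>G\<^esub> g) ` carrier G"

lemma (in group) conjugates_conj:
  assumes "x \<in> carrier G" "y \<in> conjugates G x" "g \<in> carrier G"
  shows "inv g \<otimes> y \<otimes> g \<in> conjugates G x"
proof -
  obtain h where h: "h \<in> carrier G" "y = inv h \<otimes> x \<otimes> h"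
    using assms by (auto simp: conjugates_def)
  then have "inv g \<otimes> y \<otimes> g = inv (h \<otimes> g) \<otimes> x \<otimes> (h \<otimes> g)"
    using assms by (simp add: inv_mult_group m_assoc)
  then show ?thesis
    unfolding conjugates_def using h assms by blast
qed

text \<open>
  The conjugate of \<open>x\<close> by \<open>g\<close> depends only on the coset of \<open>g\<close> modulo the centralizer.
\<close>

lemma (in group) finite_conjugates_if_centralizer_finite_index:
  assumes "N \<subseteq> carrier G" "finite (rcosets (centralizer G N))" "x \<in> N"
  shows "finite (conjugates G x)"
proof -
  let ?C = "centralizer G N"
  have "conjugates G x \<subseteq> (\<lambda>U. let h = SOME h. h \<in> U in inv h \<otimes> x \<otimes> h) ` (rcosets ?C)"
  proof
    fix y assume "y \<in> conjugates G x"
    then obtain g where g: "g \<in> carrier G" "y = inv g \<otimes> x \<otimes> g"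
      by (auto simp: conjugates_def)
    let ?h = "SOME h. h \<in> ?C #> g"
    have "\<one> \<in> ?C" using assms(1) by (auto simp: centralizer_def)
    then have "g \<in> ?C #> g" using g(1) by (force simp: r_coset_def)
    then have "?h \<in> ?C #> g" by (rule someI)
    then obtain c where c: "c \<in> ?C" "?h = c \<otimes> g"
      by (auto simp: r_coset_def)
    then have cG: "c \<in> carrier G" and cx: "c \<otimes> x = x \<otimes> c"
      using assms(3) by (auto simp: centralizer_def)
    have x: "x \<in> carrier G" using assms by auto
    have "inv c \<otimes> (x \<otimes> c) = x"
      using cG x by (simp flip: cx m_assoc)
    then have "inv ?h \<otimes> x \<otimes> ?h = y"
      unfolding c(2) g(2) using cG x g(1)
      by (simp add: inv_mult_group m_assoc) (metis m_assoc m_closed inv_closed)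
    moreover have "?C #> g \<in> rcosets ?C"
      using g(1) by (auto simp: RCOSETS_def)
    ultimately show "y \<in> (\<lambda>U. let h = SOME h. h \<in> U in inv h \<otimes> x \<otimes> h) ` (rcosets ?C)"
      by (intro image_eqI[where x = "?C #> g"]) (simp_all add: Let_def)
  qed
  then show ?thesis
    using assms(2) finite_surj by blast
qed

lemma (in group) finite_conjugates_mult:
  assumes "x \<in> carrier G" "y \<in> carrier G" "finite (conjugates G x)" "finite (conjugates G y)"
  shows "finite (conjugates G (x \<otimes> y))"
proof (rule finite_subset)
  show "conjugates G (x \<otimes> y) \<subseteq> (\<lambda>(a, b). a \<otimes> b) ` (conjugates G x \<times> conjugates G y)"
  proof
    fix z assume "z \<in> conjugates G (x \<otimes> y)"
    then obtain g where g: "g \<in> carrier G" "z = inv g \<otimes> (x \<otimes> y) \<otimes> g"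
      by (auto simp: conjugates_def)
    have "g \<otimes> (inv g \<otimes> (y \<otimes> g)) = y \<otimes> g"
      using assms g(1) by (simp flip: m_assoc)
    then have "z = (inv g \<otimes> x \<otimes> g) \<otimes> (inv g \<otimes> y \<otimes> g)"
      using assms g by (simp add: m_assoc)
    then show "z \<in> (\<lambda>(a, b). a \<otimes> b) ` (conjugates G x \<times> conjugates G y)"
      using g(1) by (auto simp: conjugates_def)
  qed
qed (use assms in auto)

lemma (in group) conjugates_inv:
  assumes "x \<in> carrier G"
  shows "conjugates G (inv x) = m_inv G ` conjugates G x"
  unfolding conjugates_def image_image
  using assms by (intro image_cong) (auto simp: inv_mult_group m_assoc)

definition socle_summand :: "'a set \<Rightarrow> ('a, 'b) monoid_scheme \<Rightarrow> bool" where
  "socle_summand N G \<longleftrightarrow>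
     minimal_normal N G \<and> comm_group (G\<lparr>carrier := N\<rparr>) \<and> torsion_group (G\<lparr>carrier := N\<rparr>)"

lemma torsion_socle_eq: "torsion_socle G = generate G (\<Union>{N. socle_summand N G})"
  by (simp add: torsion_socle_def socle_summand_def)

lemma (in group) socle_summand_subset_carrier: "socle_summand N G \<Longrightarrow> N \<subseteq> carrier G"
  unfolding socle_summand_def minimal_normal_def by (meson normal_imp_subgroup subgroup.subset)

lemma (in group) socle_summand_subset: "socle_summand N G \<Longrightarrow> N \<subseteq> torsion_socle G"
  unfolding torsion_socle_eq by (auto intro: generate.incl)

text \<open>
  Two distinct minimal normal subgroups intersect trivially and hence commute, so all generators of the
  torsion socle commute.
\<close>

lemma (in group) torsion_socle_commute:
  assumes "x \<in> torsion_socle G" "y \<in> torsion_socle G"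
  shows "x \<otimes> y = y \<otimes> x"
proof -
  let ?U = "\<Union>{N. socle_summand N G}"
  have U: "?U \<subseteq> carrier G"
    using socle_summand_subset_carrier by blast
  have UU: "x \<otimes> y = y \<otimes> x" if xyU: "x \<in> ?U" "y \<in> ?U" for x y
  proof -
    obtain N M where NM: "socle_summand N G" "socle_summand M G" "x \<in> N" "y \<in> M"
      using xyU by auto
    then have nor: "N \<lhd> G" "M \<lhd> G"
      by (auto simp: socle_summand_def minimal_normal_def)
    show ?thesis
    proof (cases "N = M")
      case True
      then interpret N: comm_group "G\<lparr>carrier := N\<rparr>"
        using NM by (simp add: socle_summand_def)
      show ?thesis using N.m_comm NM True by simp
    next
      case False
      have "N \<inter> M \<lhd> G"
        using nor by (rule normal_subgroup_intersect)
      then have "N \<inter> M = {\<one>} \<or> N \<inter> M = N" "N \<inter> M = {\<one>} \<or> N \<inter> M = M"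
        using NM(1,2) unfolding socle_summand_def minimal_normal_def by blast+
      then have "N \<inter> M = {\<one>}" using False by auto
      then show ?thesis using normal_Int_trivial_imp_commute nor NM by blast
    qed
  qed
  have comm_inv: "inv a \<otimes> b = b \<otimes> inv a" if "a \<in> carrier G" "b \<in> carrier G" "a \<otimes> b = b \<otimes> a" for a b
    using that by (metis inv_closed inv_solve_left inv_solve_right m_assoc m_closed)
  have comm_mult: "(a \<otimes> b) \<otimes> c = c \<otimes> (a \<otimes> b)"
    if "a \<in> carrier G" "b \<in> carrier G" "c \<in> carrier G" "a \<otimes> c = c \<otimes> a" "b \<otimes> c = c \<otimes> b" for a b c
    using that by (metis m_assoc)
  have 1: "x \<otimes> y = y \<otimes> x" if "x \<in> generate G ?U" "y \<in> ?U" for x y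
    using that
  proof (induction rule: generate.induct)
    case one then show ?case using U by auto
  next
    case (incl h) then show ?case using UU by blast
  next
    case (inv h) then show ?case using UU U comm_inv by blast
  next
    case (eng a b)
    then show ?case using comm_mult generate_in_carrier[OF U] U by blast
  qed
  have "x \<otimes> y = y \<otimes> x" if "y \<in> generate G ?U" "x \<in> generate G ?U" for x y
    using that
  proof (induction rule: generate.induct)
    case one then show ?case using generate_in_carrier[OF U] by simp
  next
    case (incl h) then show ?case using 1 by blast
  next
    case (inv h) then show ?case using 1 comm_inv generate_in_carrier[OF U] U by (metis subsetD)
  next
    case (eng a b)
    then show ?case using comm_mult generate_in_carrier[OF U] by metis
  qed
  then show ?thesis
    using assms unfolding torsion_socle_eq by blast
qed

lemma (in group) torsion_socle_torsion:
  assumes "x \<in> torsion_socle G"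
  shows "\<exists>n>0. x [^] (n::nat) = \<one>"
proof -
  let ?U = "\<Union>{N. socle_summand N G}"
  have U: "?U \<subseteq> carrier G"
    using socle_summand_subset_carrier by blast
  have *: "\<exists>n>0. x [^] (n::nat) = \<one>" if xU: "x \<in> ?U" for x
  proof -
    obtain N where N: "socle_summand N G" "x \<in> N" using xU by blast
    then have "torsion_group (G\<lparr>carrier := N\<rparr>)" "subgroup N G"
      by (auto simp: socle_summand_def minimal_normal_def normal_imp_subgroup)
    then show ?thesis
      using N(2) by (auto simp: torsion_group_def nat_pow_consistent[symmetric])
  qed
  show ?thesis
    using assms unfolding torsion_socle_eq
  proof (induction rule: generate.induct)
    case one then show ?case by auto
  next
    case (incl h) then show ?case using * by blast
  next
    case (inv h) then show ?case using * U by (metis inv_one nat_pow_inv subsetD)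
  next
    case (eng a b)
    then obtain m n where mn: "m > 0" "a [^] (m::nat) = \<one>" "n > 0" "b [^] (n::nat) = \<one>" by blast
    have ab: "a \<in> carrier G" "b \<in> carrier G"
      using eng generate_in_carrier[OF U] by blast+
    have "a \<otimes> b = b \<otimes> a"
      using eng torsion_socle_commute unfolding torsion_socle_eq by blast
    then have "(a \<otimes> b) [^] (m * n) = (a [^] m) [^] n \<otimes> (b [^] n) [^] m"
      using ab pow_mult_distrib[of a b "m * n"] by (simp add: nat_pow_pow mult.commute[of n])
    then have "(a \<otimes> b) [^] (m * n) = \<one>" using mn by simp
    then show ?case using mn by (metis nat_0_less_mult_iff)
  qed
qed

lemma (in group) torsion_socle_finite_conjugates:
  assumes fin: "\<And>N. minimal_normal N G \<Longrightarrow> N \<subseteq> torsion_socle G \<Longrightarrow> finite (rcosets (centralizer G N))"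
    and "x \<in> torsion_socle G"
  shows "finite (conjugates G x)"
proof -
  let ?U = "\<Union>{N. socle_summand N G}"
  have U: "?U \<subseteq> carrier G"
    using socle_summand_subset_carrier by blast
  have *: "finite (conjugates G x)" if xU: "x \<in> ?U" for x
  proof -
    obtain N where N: "socle_summand N G" "x \<in> N" using xU by blast
    then have "finite (rcosets (centralizer G N))"
      using fin socle_summand_subset by (simp add: socle_summand_def)
    then show ?thesis
      using finite_conjugates_if_centralizer_finite_index socle_summand_subset_carrier N by blast
  qed
  show ?thesis
    using assms(2) unfolding torsion_socle_eq
  proof (induction rule: generate.induct)
    case one
    have "conjugates G \<one> \<subseteq> {\<one>}" by (auto simp: conjugates_def)
    then show ?case using finite_subset by blast
  next
    case (incl h) then show ?case using * by blast
  next
    case (inv h) then show ?case using * U conjugates_inv by (metis finite_imageI subsetD)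
  next
    case (eng a b)
    then show ?case using generate_in_carrier[OF U] finite_conjugates_mult by blast
  qed
qed

lemma (in group) torsion_socle_normal: "torsion_socle G \<lhd> G"
  unfolding torsion_socle_eq
proof (rule normal_generateI)
  show "\<Union>{N. socle_summand N G} \<subseteq> carrier G"
    using socle_summand_subset_carrier by blast
  fix x g assume x: "x \<in> \<Union>{N. socle_summand N G}" and g: "g \<in> carrier G"
  then obtain N where N: "socle_summand N G" "x \<in> N" by blast
  then have "N \<lhd> G" by (simp add: socle_summand_def minimal_normal_def)
  then show "g \<otimes> x \<otimes> inv g \<in> \<Union>{N. socle_summand N G}"
    using normal.inv_op_closed2[of N G g x] g N by blast
qed

section \<open>Normal cores\<close>

lemma normal_core_imp_conjugates_subset:
  assumes "group G" "S \<subseteq> carrier G" "x \<in> normal_core G S"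
  shows "conjugates G x \<subseteq> S"
proof
  interpret group G by fact
  fix y assume "y \<in> conjugates G x"
  then obtain g where g: "g \<in> carrier G" "y = inv\<^bsub>G\<^esub> g \<otimes>\<^bsub>G\<^esub> x \<otimes>\<^bsub>G\<^esub> g"
    by (auto simp: conjugates_def)
  then obtain s where s: "s \<in> S" "x = g \<otimes>\<^bsub>G\<^esub> s \<otimes>\<^bsub>G\<^esub> inv\<^bsub>G\<^esub> g"
    using assms(3) by (auto simp: normal_core_def l_coset_def r_coset_def)
  have sG: "s \<in> carrier G" using s(1) assms(2) by blast
  have "inv\<^bsub>G\<^esub> g \<otimes>\<^bsub>G\<^esub> (g \<otimes>\<^bsub>G\<^esub> s) = s"
    using sG g(1) by (simp flip: m_assoc)
  then have "y = s"
    using g s(2) sG by (simp add: m_assoc)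
  then show "y \<in> S" using s(1) by simp
qed

lemma normal_core_subset:
  assumes "group G" "S \<subseteq> carrier G"
  shows "normal_core G S \<subseteq> S"
proof -
  interpret group G by fact
  have "(\<one>\<^bsub>G\<^esub> <#\<^bsub>G\<^esub> S) #>\<^bsub>G\<^esub> inv\<^bsub>G\<^esub> \<one>\<^bsub>G\<^esub> = S"
    using assms(2) by (simp add: lcos_mult_one coset_mult_one)
  then show ?thesis unfolding normal_core_def by blast
qed

lemma one_in_normal_core:
  assumes "group G" "\<one>\<^bsub>G\<^esub> \<in> S"
  shows "\<one>\<^bsub>G\<^esub> \<in> normal_core G S"
proof -
  interpret group G by fact
  have "\<one>\<^bsub>G\<^esub> \<in> (g <#\<^bsub>G\<^esub> S) #>\<^bsub>G\<^esub> inv\<^bsub>G\<^esub> g" if "g \<in> carrier G" for g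
    using that assms(2) unfolding l_coset_def r_coset_def
    by (auto intro!: bexI[of _ "\<one>\<^bsub>G\<^esub>"])
  then show ?thesis unfolding normal_core_def by blast
qed

section \<open>Faithful irreducible representations and abelian normal subgroups\<close>

locale faithful_irreducible_with_abelian_normal =
  fixes G :: "('a, 'b) monoid_scheme" and K :: "('k, 'm) ring_scheme"
    and V :: "('k, 'v, 'n) module_scheme" and \<rho> :: "'a \<Rightarrow> 'v \<Rightarrow> 'v" and T :: "'a set"
  assumes faithful: "faithful_rep G K V \<rho>" and irreducible: "irreducible_rep G K V \<rho>"
    and normal: "T \<lhd> G"
    and T_commute: "\<And>s t. s \<in> T \<Longrightarrow> t \<in> T \<Longrightarrow> s \<otimes>\<^bsub>G\<^esub> t = t \<otimes>\<^bsub>G\<^esub> s"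
begin

sublocale G: group G
  using faithful by (simp add: faithful_rep_def representation_def)

sublocale K: field K
  using faithful by (simp add: faithful_rep_def representation_def)

sublocale V: Module.module K V
  using faithful by (simp add: faithful_rep_def representation_def)

sublocale T: normal T G by (rule normal)

sublocale E: ring "additive_endos V"
  by (rule V.M.ring_additive_endos)

lemma rho_GL: "g \<in> carrier G \<Longrightarrow> \<rho> g \<in> carrier (GL K V)"
  using faithful by (auto simp: faithful_rep_def representation_def hom_def)

lemma rho_Bij: "g \<in> carrier G \<Longrightarrow> \<rho> g \<in> Bij (carrier V)"
  using rho_GL by (simp add: GL_def)

lemma rho_closed [simp, intro]: "g \<in> carrier G \<Longrightarrow> v \<in> carrier V \<Longrightarrow> \<rho> g v \<in> carrier V"
  using rho_Bij Bij_imp_funcset by blast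

lemma rho_add: "g \<in> carrier G \<Longrightarrow> v \<in> carrier V \<Longrightarrow> w \<in> carrier V \<Longrightarrow>
    \<rho> g (v \<oplus>\<^bsub>V\<^esub> w) = \<rho> g v \<oplus>\<^bsub>V\<^esub> \<rho> g w"
  using rho_GL by (simp add: GL_def)

lemma rho_smult: "g \<in> carrier G \<Longrightarrow> a \<in> carrier K \<Longrightarrow> v \<in> carrier V \<Longrightarrow>
    \<rho> g (a \<odot>\<^bsub>V\<^esub> v) = a \<odot>\<^bsub>V\<^esub> \<rho> g v"
  using rho_GL by (simp add: GL_def)

lemma rho_mult:
  assumes "g \<in> carrier G" "h \<in> carrier G"
  shows "\<rho> (g \<otimes>\<^bsub>G\<^esub> h) = compose (carrier V) (\<rho> g) (\<rho> h)"
proof -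
  have "\<rho> (g \<otimes>\<^bsub>G\<^esub> h) = \<rho> g \<otimes>\<^bsub>GL K V\<^esub> \<rho> h"
    using faithful assms by (auto simp: faithful_rep_def representation_def hom_def)
  then show ?thesis
    using assms rho_Bij by (simp add: GL_def BijGroup_def)
qed

lemma rho_mult_apply:
  "g \<in> carrier G \<Longrightarrow> h \<in> carrier G \<Longrightarrow> v \<in> carrier V \<Longrightarrow> \<rho> (g \<otimes>\<^bsub>G\<^esub> h) v = \<rho> g (\<rho> h v)"
  by (simp add: rho_mult compose_eq)

lemma rho_one: "\<rho> \<one>\<^bsub>G\<^esub> = (\<lambda>v\<in>carrier V. v)"
proof -
  have "\<rho> \<in> hom G (BijGroup (carrier V))"
    using rho_Bij rho_mult by (auto simp: hom_def BijGroup_def)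
  then have "\<rho> \<one>\<^bsub>G\<^esub> = \<one>\<^bsub>BijGroup (carrier V)\<^esub>"
    using hom_one G.group_axioms group_BijGroup by blast
  then show ?thesis by (simp add: BijGroup_def)
qed

text \<open>
  The common fixed vectors of \<open>C\<close> form a subspace, which is \<open>G\<close>-invariant because \<open>C\<close> is closed under
  conjugation.  By irreducibility it is all of \<open>V\<close>, so \<open>C\<close> acts trivially.
\<close>

lemma subset_one_if_common_fixed_vector:
  assumes C: "C \<subseteq> carrier G" and conj: "\<And>x g. x \<in> C \<Longrightarrow> g \<in> carrier G \<Longrightarrow> inv\<^bsub>G\<^esub> g \<otimes>\<^bsub>G\<^esub> x \<otimes>\<^bsub>G\<^esub> g \<in> C"
    and v: "v \<in> carrier V" "v \<noteq> \<zero>\<^bsub>V\<^esub>" "\<And>x. x \<in> C \<Longrightarrow> \<rho> x v = v"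
  shows "C \<subseteq> {\<one>\<^bsub>G\<^esub>}"
proof
  let ?W = "{w \<in> carrier V. \<forall>x\<in>C. \<rho> x w = w}"
  have smult: "a \<odot>\<^bsub>V\<^esub> w \<in> ?W" if "a \<in> carrier K" "w \<in> ?W" for a w
    using that C by (auto simp: rho_smult subset_iff)
  have "submodule ?W K V"
  proof (rule V.submoduleI)
    show "\<zero>\<^bsub>V\<^esub> \<in> ?W"
      using smult[OF K.zero_closed, of v] v by simp
    show "\<ominus>\<^bsub>V\<^esub> w \<in> ?W" if "w \<in> ?W" for w
      using smult[of "\<ominus>\<^bsub>K\<^esub> \<one>\<^bsub>K\<^esub>" w] that by (simp add: V.smult_l_minus)
    show "u \<oplus>\<^bsub>V\<^esub> w \<in> ?W" if "u \<in> ?W" "w \<in> ?W" for u w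
      using that C by (auto simp: rho_add subset_iff)
  qed (use smult in auto)
  moreover have "\<rho> g ` ?W \<subseteq> ?W" if g: "g \<in> carrier G" for g
  proof safe
    fix w x assume w: "w \<in> carrier V" "\<forall>x\<in>C. \<rho> x w = w" and x: "x \<in> C"
    have xG: "x \<in> carrier G" using x C by blast
    let ?y = "inv\<^bsub>G\<^esub> g \<otimes>\<^bsub>G\<^esub> x \<otimes>\<^bsub>G\<^esub> g"
    have "g \<otimes>\<^bsub>G\<^esub> ?y = x \<otimes>\<^bsub>G\<^esub> g"
      using xG g by (simp flip: G.m_assoc)
    then have "\<rho> x (\<rho> g w) = \<rho> g (\<rho> ?y w)"
      using xG g w(1) by (simp flip: rho_mult_apply)
    also have "\<rho> ?y w = w" using conj[OF x g] w(2) by blast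
    finally show "\<rho> x (\<rho> g w) = \<rho> g w" .
  qed (use g in auto)
  ultimately have "?W = {\<zero>\<^bsub>V\<^esub>} \<or> ?W = carrier V"
    using irreducible unfolding irreducible_rep_def by blast
  then have W: "?W = carrier V" using v by blast
  fix x assume x: "x \<in> C"
  have "\<rho> x = \<rho> \<one>\<^bsub>G\<^esub>"
  proof (rule extensionalityI)
    show "\<rho> x \<in> extensional (carrier V)"
      using rho_Bij x C Bij_imp_extensional by blast
    show "\<rho> x w = \<rho> \<one>\<^bsub>G\<^esub> w" if "w \<in> carrier V" for w
      using that W x by (auto simp: rho_one)
  qed (simp add: rho_one)
  then show "x \<in> {\<one>\<^bsub>G\<^esub>}"
    using faithful x C G.one_closed unfolding faithful_rep_def by (auto dest!: inj_onD)
qed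

definition scalar :: "'k \<Rightarrow> 'v \<Rightarrow> 'v" where
  "scalar a = (\<lambda>v\<in>carrier V. a \<odot>\<^bsub>V\<^esub> v)"

abbreviation gens :: "('v \<Rightarrow> 'v) set" where
  "gens \<equiv> \<rho> ` T \<union> scalar ` carrier K"

text \<open>
  The scalars are included among the generators so that the integers that are invertible in \<open>K\<close> are
  units of \<open>A\<close>, and all residue fields of \<open>A\<close> have the characteristic of \<open>K\<close>.
\<close>

definition A :: "('v \<Rightarrow> 'v) ring" where
  "A = additive_endos V
     \<lparr>carrier := commutant (additive_endos V) (commutant (additive_endos V) gens)\<rparr>"

lemma gens_subset: "gens \<subseteq> carrier (additive_endos V)"
proof -
  have "\<rho> t \<in> carrier (additive_endos V)" if "t \<in> T" for t
    using that rho_Bij[of t] rho_add[of t] rho_closed[of t] T.subset Bij_imp_extensional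
    by (auto simp: additive_endos_def PiE_iff subset_iff)
  moreover have "scalar a \<in> carrier (additive_endos V)" if "a \<in> carrier K" for a
    using that by (auto simp: additive_endos_def scalar_def V.smult_r_distr)
  ultimately show ?thesis by auto
qed

lemma gens_commute:
  assumes "x \<in> gens" "y \<in> gens"
  shows "x \<otimes>\<^bsub>additive_endos V\<^esub> y = y \<otimes>\<^bsub>additive_endos V\<^esub> x"
proof -
  have rr: "compose (carrier V) (\<rho> s) (\<rho> t) = compose (carrier V) (\<rho> t) (\<rho> s)" if "s \<in> T" "t \<in> T" for s t
    using that T_commute[OF that] T.mem_carrier by (simp flip: rho_mult)
  have rs: "compose (carrier V) (\<rho> t) (scalar a) = compose (carrier V) (scalar a) (\<rho> t)"
    if "t \<in> T" "a \<in> carrier K" for t a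
    using that by (auto simp: compose_def scalar_def rho_smult)
  have ss: "compose (carrier V) (scalar a) (scalar b) = compose (carrier V) (scalar b) (scalar a)"
    if "a \<in> carrier K" "b \<in> carrier K" for a b
    using that by (auto simp: compose_def scalar_def K.m_comm simp flip: V.smult_assoc1)
  show ?thesis
    using assms rr rs ss by (auto simp: additive_endos_def)
qed

sublocale A: cring A
  unfolding A_def
  using E.subcring_bicommutant(1)[OF gens_subset gens_commute] E.subcring_iff
    subcringE(1) by blast

lemma gens_in_A: "x \<in> gens \<Longrightarrow> x \<in> carrier A"
  using E.subcring_bicommutant(2)[OF gens_subset gens_commute] by (auto simp: A_def)

lemma A_carrier_subset: "carrier A \<subseteq> carrier (additive_endos V)"
  by (auto simp: A_def commutant_def)

lemma A_simps:
  "monoid.mult A = compose (carrier V)" "\<one>\<^bsub>A\<^esub> = (\<lambda>v\<in>carrier V. v)" "\<zero>\<^bsub>A\<^esub> = (\<lambda>v\<in>carrier V. \<zero>\<^bsub>V\<^esub>)"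
  "f \<oplus>\<^bsub>A\<^esub> g = (\<lambda>v\<in>carrier V. f v \<oplus>\<^bsub>V\<^esub> g v)"
  by (simp_all add: A_def additive_endos_def)

lemma rho_in_A [simp, intro]: "t \<in> T \<Longrightarrow> \<rho> t \<in> carrier A"
  by (intro gens_in_A) auto

lemma scalar_in_A [simp, intro]: "a \<in> carrier K \<Longrightarrow> scalar a \<in> carrier A"
  by (intro gens_in_A) auto

lemma rho_mult_A: "s \<in> T \<Longrightarrow> t \<in> T \<Longrightarrow> \<rho> (s \<otimes>\<^bsub>G\<^esub> t) = \<rho> s \<otimes>\<^bsub>A\<^esub> \<rho> t"
  by (simp add: A_simps rho_mult)

lemma rho_one_A: "\<rho> \<one>\<^bsub>G\<^esub> = \<one>\<^bsub>A\<^esub>"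
  by (simp add: A_simps rho_one)

lemma rho_pow_A:
  assumes "t \<in> T"
  shows "\<rho> (t [^]\<^bsub>G\<^esub> (n::nat)) = \<rho> t [^]\<^bsub>A\<^esub> n"
proof (induction n)
  case (Suc n)
  have "t [^]\<^bsub>G\<^esub> n \<in> T"
    using assms by (induction n) auto
  then show ?case using Suc assms by (simp add: rho_mult_A)
qed (simp add: rho_one_A)

lemma one_not_zero_A: "\<one>\<^bsub>A\<^esub> \<noteq> \<zero>\<^bsub>A\<^esub>"
proof
  assume "\<one>\<^bsub>A\<^esub> = \<zero>\<^bsub>A\<^esub>"
  then have "v = \<zero>\<^bsub>V\<^esub>" if "v \<in> carrier V" for v
    using that unfolding A_simps by (metis restrict_apply')
  then have "carrier V = {\<zero>\<^bsub>V\<^esub>}" by auto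
  then show False using irreducible by (simp add: irreducible_rep_def)
qed

lemma add_pow_one_A: "add_pow A (n::nat) \<one>\<^bsub>A\<^esub> = scalar (add_pow K n \<one>\<^bsub>K\<^esub>)"
proof (induction n)
  case 0
  show ?case by (auto simp: A_simps scalar_def)
next
  case (Suc n)
  have "add_pow K n \<one>\<^bsub>K\<^esub> \<in> carrier K" by simp
  then show ?case
    using Suc by (auto simp: A.add.nat_pow_Suc A_simps scalar_def V.smult_l_distr)
qed

lemma add_pow_one_notin_ideal:
  assumes "ideal I A" "I \<noteq> carrier A" "add_pow K (n::nat) \<one>\<^bsub>K\<^esub> \<noteq> \<zero>\<^bsub>K\<^esub>"
  shows "add_pow A n \<one>\<^bsub>A\<^esub> \<notin> I"
proof
  assume n: "add_pow A n \<one>\<^bsub>A\<^esub> \<in> I"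
  let ?c = "add_pow K n \<one>\<^bsub>K\<^esub>"
  have "?c \<in> Units K" using assms(3) by (simp add: K.field_Units)
  then have c: "?c \<in> carrier K" "inv\<^bsub>K\<^esub> ?c \<in> carrier K" "?c \<otimes>\<^bsub>K\<^esub> inv\<^bsub>K\<^esub> ?c = \<one>\<^bsub>K\<^esub>" by auto
  have "scalar ?c \<otimes>\<^bsub>A\<^esub> scalar (inv\<^bsub>K\<^esub> ?c) \<in> I"
    using ideal.I_r_closed[OF assms(1) n] c(2) by (simp add: add_pow_one_A)
  also have "scalar ?c \<otimes>\<^bsub>A\<^esub> scalar (inv\<^bsub>K\<^esub> ?c) = \<one>\<^bsub>A\<^esub>"
    using c by (auto simp: A_simps compose_def scalar_def simp flip: V.smult_assoc1)
  finally show False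
    using ideal.one_imp_carrier assms by blast
qed

text \<open>
  Every value \<open>b v\<close> is a common fixed vector of \<open>C\<close>, and some value is non-zero.
\<close>

lemma subset_one_if_fixed_in_A:
  assumes C: "C \<subseteq> T" and conj: "\<And>x g. x \<in> C \<Longrightarrow> g \<in> carrier G \<Longrightarrow> inv\<^bsub>G\<^esub> g \<otimes>\<^bsub>G\<^esub> x \<otimes>\<^bsub>G\<^esub> g \<in> C"
    and b: "b \<in> carrier A" "b \<noteq> \<zero>\<^bsub>A\<^esub>" "\<And>x. x \<in> C \<Longrightarrow> \<rho> x \<otimes>\<^bsub>A\<^esub> b = b"
  shows "C \<subseteq> {\<one>\<^bsub>G\<^esub>}"
proof -
  have bE: "b \<in> carrier V \<rightarrow>\<^sub>E carrier V"
    using b(1) A_carrier_subset by (auto simp: additive_endos_def)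
  obtain v where v: "v \<in> carrier V" "b v \<noteq> \<zero>\<^bsub>V\<^esub>"
  proof (rule ccontr)
    assume "\<not> thesis"
    then have "\<And>v. v \<in> carrier V \<Longrightarrow> b v = \<zero>\<^bsub>V\<^esub>" using that by blast
    then have "b = \<zero>\<^bsub>A\<^esub>" using bE by (auto simp: A_simps PiE_iff extensional_def)
    then show False using b by simp
  qed
  show ?thesis
  proof (rule subset_one_if_common_fixed_vector[OF _ conj])
    show "b v \<in> carrier V" using bE v by auto
    show "\<rho> x (b v) = b v" if "x \<in> C" for x
      using b(3)[OF that] v(1) unfolding A_simps by (metis compose_eq)
  qed (use C v(2) T.subset in auto)
qed

lemma conjugates_subset_T: "x \<in> T \<Longrightarrow> conjugates G x \<subseteq> T"
  by (auto simp: conjugates_def T.inv_op_closed1)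

lemma self_in_conjugates: "x \<in> T \<Longrightarrow> x \<in> conjugates G x"
  unfolding conjugates_def by (rule image_eqI[of _ _ "\<one>\<^bsub>G\<^esub>"]) auto

lemma pow_conj:
  assumes "x \<in> T" "y \<in> conjugates G x" "x [^]\<^bsub>G\<^esub> (n::nat) = \<one>\<^bsub>G\<^esub>"
  shows "y [^]\<^bsub>G\<^esub> n = \<one>\<^bsub>G\<^esub>"
proof -
  obtain g where g: "g \<in> carrier G" "y = inv\<^bsub>G\<^esub> g \<otimes>\<^bsub>G\<^esub> x \<otimes>\<^bsub>G\<^esub> g"
    using assms(2) by (auto simp: conjugates_def)
  have "y [^]\<^bsub>G\<^esub> n = inv\<^bsub>G\<^esub> g \<otimes>\<^bsub>G\<^esub> x [^]\<^bsub>G\<^esub> n \<otimes>\<^bsub>G\<^esub> g"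
  proof (induction n)
    case (Suc n)
    have xG: "x \<in> carrier G" using assms by auto
    have "g \<otimes>\<^bsub>G\<^esub> (inv\<^bsub>G\<^esub> g \<otimes>\<^bsub>G\<^esub> (x \<otimes>\<^bsub>G\<^esub> g)) = x \<otimes>\<^bsub>G\<^esub> g"
      using xG g(1) by (simp flip: G.m_assoc)
    then show ?case using Suc g xG by (simp add: G.m_assoc)
  qed (use g in simp)
  then show ?thesis using g assms by simp
qed

text \<open>
  The operators \<open>\<rho> y - 1\<close> with \<open>y\<close> conjugate to \<open>x\<close> are nilpotent, since \<open>\<rho> y\<close> is a \<open>q\<close>-th root of unity in
  characteristic \<open>q\<close>.  They are finite in number, so a non-zero \<open>b\<close> is annihilated by all of them, which
  means that \<open>b\<close> is fixed by the conjugacy class of \<open>x\<close>.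
\<close>

lemma no_torsion_at_characteristic:
  assumes q: "Factorial_Ring.prime q" "add_pow K (q::nat) \<one>\<^bsub>K\<^esub> = \<zero>\<^bsub>K\<^esub>"
    and x: "x \<in> T" "x [^]\<^bsub>G\<^esub> q = \<one>\<^bsub>G\<^esub>" "finite (conjugates G x)"
  shows "x = \<one>\<^bsub>G\<^esub>"
proof -
  have char: "add_pow A q \<one>\<^bsub>A\<^esub> = \<zero>\<^bsub>A\<^esub>"
    unfolding add_pow_one_A q(2) by (auto simp: scalar_def A_simps)
  let ?Y = "(\<lambda>y. \<rho> y \<ominus>\<^bsub>A\<^esub> \<one>\<^bsub>A\<^esub>) ` conjugates G x"
  have "\<exists>n. z [^]\<^bsub>A\<^esub> (n::nat) = \<zero>\<^bsub>A\<^esub>" if z: "z \<in> ?Y" for z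
  proof -
    obtain y where y: "y \<in> conjugates G x" "z = \<rho> y \<ominus>\<^bsub>A\<^esub> \<one>\<^bsub>A\<^esub>" using z by blast
    then have yT: "y \<in> T" using conjugates_subset_T x(1) by blast
    have "\<rho> y [^]\<^bsub>A\<^esub> q = \<one>\<^bsub>A\<^esub>"
      using pow_conj[OF x(1) y(1) x(2)] yT by (simp flip: rho_pow_A add: rho_one_A)
    then show ?thesis
      using A.nilpotent_minus_one[OF _ _ q(1) char] yT y(2) by blast
  qed
  moreover have "?Y \<subseteq> carrier A"
    using conjugates_subset_T[OF x(1)] by auto
  ultimately obtain b where b: "b \<in> carrier A" "b \<noteq> \<zero>\<^bsub>A\<^esub>" "\<And>z. z \<in> ?Y \<Longrightarrow> z \<otimes>\<^bsub>A\<^esub> b = \<zero>\<^bsub>A\<^esub>"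
    using A.ex_annihilated_by_nilpotents[OF one_not_zero_A, of ?Y] x(3) by blast
  have "\<rho> y \<otimes>\<^bsub>A\<^esub> b = b" if "y \<in> conjugates G x" for y
  proof -
    have r: "\<rho> y \<in> carrier A" using that conjugates_subset_T[OF x(1)] by blast
    have "\<rho> y \<otimes>\<^bsub>A\<^esub> b \<ominus>\<^bsub>A\<^esub> b = (\<rho> y \<ominus>\<^bsub>A\<^esub> \<one>\<^bsub>A\<^esub>) \<otimes>\<^bsub>A\<^esub> b"
      using r b(1) by (simp add: A.minus_eq A.l_distr A.l_minus)
    also have "\<dots> = \<zero>\<^bsub>A\<^esub>" using b(3) that by blast
    finally show ?thesis using r b(1) by simp
  qed
  then have "conjugates G x \<subseteq> {\<one>\<^bsub>G\<^esub>}"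
    using subset_one_if_fixed_in_A[OF conjugates_subset_T[OF x(1)] _ b(1,2)]
      G.conjugates_conj x(1) T.mem_carrier by blast
  then show ?thesis using self_in_conjugates[OF x(1)] by blast
qed

text \<open>
  Otherwise a prime \<open>q\<close> dividing the order of \<open>x\<close> is zero in \<open>K\<close>, and a suitable power of \<open>x\<close> has order \<open>q\<close>.
\<close>

lemma ord_nonzero_in_field:
  assumes tors: "\<And>x. x \<in> T \<Longrightarrow> \<exists>n>0. x [^]\<^bsub>G\<^esub> (n::nat) = \<one>\<^bsub>G\<^esub>"
    and fin: "\<And>x. x \<in> T \<Longrightarrow> finite (conjugates G x)"
    and x: "x \<in> T"
  shows "add_pow K (G.ord x) \<one>\<^bsub>K\<^esub> \<noteq> \<zero>\<^bsub>K\<^esub>"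
proof
  assume zero: "add_pow K (G.ord x) \<one>\<^bsub>K\<^esub> = \<zero>\<^bsub>K\<^esub>"
  have xG: "x \<in> carrier G" using x by auto
  have pos: "G.ord x > 0"
    using tors[OF x] G.ord_eq_0[OF xG] by (metis gr0I less_irrefl)
  obtain q where q: "Factorial_Ring.prime q" "q dvd G.ord x" "add_pow K q \<one>\<^bsub>K\<^esub> = \<zero>\<^bsub>K\<^esub>"
    using K.ex_prime_dvd_add_pow_eq_zero[OF pos zero] by blast
  obtain m where m: "G.ord x = m * q" using q(2) by (metis dvdE mult.commute)
  have "(x [^]\<^bsub>G\<^esub> m) [^]\<^bsub>G\<^esub> q = \<one>\<^bsub>G\<^esub>"
    using xG G.pow_ord_eq_1[OF xG] by (simp add: G.nat_pow_pow m)
  moreover have xm: "x [^]\<^bsub>G\<^esub> m \<in> T"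
    using x by (induction m) auto
  ultimately have "x [^]\<^bsub>G\<^esub> m = \<one>\<^bsub>G\<^esub>"
    using no_torsion_at_characteristic[OF q(1,3) xm] fin by blast
  then have "m * q dvd m" using xG by (simp add: G.pow_eq_id flip: m)
  then show False using pos m prime_gt_1_nat[OF q(1)] by (auto dest: dvd_imp_le)
qed

lemma p_part_trivial_at_characteristic:
  assumes q: "Factorial_Ring.prime q" "add_pow K (q::nat) \<one>\<^bsub>K\<^esub> = \<zero>\<^bsub>K\<^esub>"
    and fin: "\<And>x. x \<in> T \<Longrightarrow> finite (conjugates G x)"
  shows "p_part G T q = {\<one>\<^bsub>G\<^esub>}"
proof -
  have "x = \<one>\<^bsub>G\<^esub>" if "x \<in> T" "x [^]\<^bsub>G\<^esub> (q ^ k) = \<one>\<^bsub>G\<^esub>" for x k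
    using that
  proof (induction k arbitrary: x)
    case (Suc k)
    have xG: "x \<in> carrier G" using Suc.prems by auto
    have "x [^]\<^bsub>G\<^esub> q \<in> T"
      using Suc.prems(1) by (induction q) auto
    moreover have "(x [^]\<^bsub>G\<^esub> q) [^]\<^bsub>G\<^esub> (q ^ k) = \<one>\<^bsub>G\<^esub>"
      using Suc.prems(2) xG by (simp add: G.nat_pow_pow)
    ultimately have "x [^]\<^bsub>G\<^esub> q = \<one>\<^bsub>G\<^esub>" by (rule Suc.IH)
    then show ?case
      using no_torsion_at_characteristic[OF q Suc.prems(1)] fin Suc.prems(1) by blast
  qed auto
  moreover have "\<one>\<^bsub>G\<^esub> \<in> p_part G T q"
    by (simp add: p_part_def)
  ultimately show ?thesis unfolding p_part_def by blast
qed

text \<open>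
  \<open>S\<close> is the kernel of the composition of \<open>\<rho>\<close> with the residue map to a field \<open>A / M\<close>.  An element \<open>x\<close> of its
  core has its whole conjugacy class in \<open>S\<close>, where \<open>\<rho>\<close> is \<open>1\<close> modulo \<open>M\<close>; as the orders are invertible, some \<open>b\<close>
  outside \<open>M\<close> is fixed by that class, which forces \<open>x = 1\<close>.
\<close>

theorem ex_locally_cyclic_quotient_core_free:
  assumes tors: "\<And>x. x \<in> T \<Longrightarrow> \<exists>n>0. x [^]\<^bsub>G\<^esub> (n::nat) = \<one>\<^bsub>G\<^esub>"
    and fin: "\<And>x. x \<in> T \<Longrightarrow> finite (conjugates G x)"
  shows "\<exists>S. subgroup S (G\<lparr>carrier := T\<rparr>) \<and> locally_cyclic ((G\<lparr>carrier := T\<rparr>) Mod S) \<and>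
    normal_core G S = {\<one>\<^bsub>G\<^esub>}"
proof -
  let ?T = "G\<lparr>carrier := T\<rparr>"
  obtain M where M: "maximalideal M A"
    using A.ex_maximalideal one_not_zero_A by blast
  interpret M: maximalideal M A by (rule M)
  interpret F: field "A Quot M"
    by (rule M.quotient_is_field) (rule A.cring_axioms)
  interpret pi: ring_hom_ring A "A Quot M" "\<lambda>a. M +>\<^bsub>A\<^esub> a"
    using M.rcos_ring_hom_ring .
  interpret T: group ?T
    by (rule G.subgroup_imp_group) (rule T.subgroup_axioms)
  define \<phi> where "\<phi> t = M +>\<^bsub>A\<^esub> \<rho> t" for t
  have mult: "\<phi> (s \<otimes>\<^bsub>G\<^esub> t) = \<phi> s \<otimes>\<^bsub>A Quot M\<^esub> \<phi> t" if "s \<in> T" "t \<in> T" for s t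
    using that by (simp add: \<phi>_def rho_mult_A)
  have one: "\<phi> \<one>\<^bsub>G\<^esub> = \<one>\<^bsub>A Quot M\<^esub>"
    by (simp add: \<phi>_def rho_one_A)
  have unit: "\<phi> t \<in> Units (A Quot M)" if t: "t \<in> T" for t
  proof -
    have "\<phi> t \<otimes>\<^bsub>A Quot M\<^esub> \<phi> (inv\<^bsub>G\<^esub> t) = \<one>\<^bsub>A Quot M\<^esub>"
      "\<phi> (inv\<^bsub>G\<^esub> t) \<otimes>\<^bsub>A Quot M\<^esub> \<phi> t = \<one>\<^bsub>A Quot M\<^esub>"
      using t by (simp_all flip: mult add: one)
    moreover have "\<phi> t \<in> carrier (A Quot M)" "\<phi> (inv\<^bsub>G\<^esub> t) \<in> carrier (A Quot M)"
      using t by (simp_all add: \<phi>_def)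
    ultimately show ?thesis by (auto simp: Units_def)
  qed
  interpret U: group "units_of (A Quot M)" by (rule F.units_group)
  interpret phi: group_hom ?T "units_of (A Quot M)" \<phi>
    by unfold_locales (auto simp: hom_def units_of_def mult unit)
  define S where "S = kernel ?T (units_of (A Quot M)) \<phi>"
  have S: "S \<subseteq> T" "\<And>t. t \<in> S \<Longrightarrow> \<rho> t \<ominus>\<^bsub>A\<^esub> \<one>\<^bsub>A\<^esub> \<in> M"
  proof -
    show "S \<subseteq> T" by (auto simp: S_def kernel_def)
    fix t assume t: "t \<in> S"
    then have "t \<in> T" "M +>\<^bsub>A\<^esub> \<rho> t = M +>\<^bsub>A\<^esub> \<one>\<^bsub>A\<^esub>"
      by (auto simp: S_def kernel_def units_of_def \<phi>_def)
    then show "\<rho> t \<ominus>\<^bsub>A\<^esub> \<one>\<^bsub>A\<^esub> \<in> M"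
      using A.quotient_eq_iff_same_a_r_cos[OF M.is_ideal, of "\<rho> t" "\<one>\<^bsub>A\<^esub>"] by auto
  qed
  interpret S: normal S ?T
    unfolding S_def by (rule phi.normal_kernel)
  have "locally_cyclic (?T Mod S)"
  proof (rule F.locally_cyclic_if_embeds_in_units)
    show "group (?T Mod S)" by (rule S.factorgroup_is_group)
    show "(\<lambda>C. the_elem (\<phi> ` C)) \<in> hom (?T Mod S) (units_of (A Quot M))"
      unfolding S_def by (rule phi.FactGroup_hom)
    show "inj_on (\<lambda>C. the_elem (\<phi> ` C)) (carrier (?T Mod S))"
      unfolding S_def by (rule phi.FactGroup_inj_on)
    fix C assume "C \<in> carrier (?T Mod S)"
    then obtain t where t: "t \<in> T" "C = S #>\<^bsub>?T\<^esub> t" by (auto simp: carrier_FactGroup)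
    obtain n :: nat where n: "n > 0" "t [^]\<^bsub>?T\<^esub> n = \<one>\<^bsub>?T\<^esub>"
      using tors[OF t(1)] by (auto simp flip: G.nat_pow_consistent)
    then have "C [^]\<^bsub>?T Mod S\<^esub> n = \<one>\<^bsub>?T Mod S\<^esub>"
      using S.FactGroup_pow[of t n] t S.rcos_const[of "\<one>\<^bsub>?T\<^esub>"] S.one_closed by auto
    then show "\<exists>n>0. C [^]\<^bsub>?T Mod S\<^esub> (n::nat) = \<one>\<^bsub>?T Mod S\<^esub>" using n(1) by blast
  qed
  moreover have "normal_core G S = {\<one>\<^bsub>G\<^esub>}"
  proof
    show "{\<one>\<^bsub>G\<^esub>} \<subseteq> normal_core G S"
      using one_in_normal_core[OF G.group_axioms] S.one_closed by simp
    show "normal_core G S \<subseteq> {\<one>\<^bsub>G\<^esub>}"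
    proof
      fix x assume x: "x \<in> normal_core G S"
      have SG: "S \<subseteq> carrier G" using S(1) T.subset by blast
      have conjS: "conjugates G x \<subseteq> S"
        using normal_core_imp_conjugates_subset[OF G.group_axioms SG x] .
      have xT: "x \<in> T"
        using normal_core_subset[OF G.group_axioms SG] x S(1) by blast
      obtain b where b: "b \<in> carrier A" "b \<notin> M"
        "\<And>z. z \<in> \<rho> ` conjugates G x \<Longrightarrow> z \<otimes>\<^bsub>A\<^esub> b = b"
      proof -
        have "\<exists>b\<in>carrier A. b \<notin> M \<and> (\<forall>z\<in>\<rho> ` conjugates G x. z \<otimes>\<^bsub>A\<^esub> b = b)"
        proof (rule A.ex_fixed_not_in_primeideal)
          show "primeideal M A" using M by (rule A.maximalideal_prime)
          show "finite (\<rho> ` conjugates G x)" using fin[OF xT] by simp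
          show "\<rho> ` conjugates G x \<subseteq> carrier A" using conjugates_subset_T[OF xT] by auto
          fix z assume "z \<in> \<rho> ` conjugates G x"
          then obtain y where y: "z = \<rho> y" "y \<in> S" "y \<in> T" using conjS S(1) by blast
          have "\<rho> y [^]\<^bsub>A\<^esub> G.ord y = \<one>\<^bsub>A\<^esub>"
            using y(3) by (simp flip: rho_pow_A add: rho_one_A)
          moreover have "add_pow A (G.ord y) \<one>\<^bsub>A\<^esub> \<notin> M"
            using add_pow_one_notin_ideal[OF M.is_ideal _ ord_nonzero_in_field[OF tors fin y(3)]]
              M.I_notcarr by metis
          ultimately show "z \<ominus>\<^bsub>A\<^esub> \<one>\<^bsub>A\<^esub> \<in> M \<and> (\<exists>n. z [^]\<^bsub>A\<^esub> (n::nat) = \<one>\<^bsub>A\<^esub> \<and> add_pow A n \<one>\<^bsub>A\<^esub> \<notin> M)"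
            using S(2) y by blast
        qed
        then show ?thesis using that by blast
      qed
      have "b \<noteq> \<zero>\<^bsub>A\<^esub>" using b(2) M.zero_closed by metis
      then have "conjugates G x \<subseteq> {\<one>\<^bsub>G\<^esub>}"
        using subset_one_if_fixed_in_A[OF conjugates_subset_T[OF xT] _ b(1)] b(3)
          G.conjugates_conj xT T.mem_carrier by blast
      then show "x \<in> {\<one>\<^bsub>G\<^esub>}" using self_in_conjugates[OF xT] by blast
    qed
  qed
  moreover have "subgroup S ?T" by (rule S.subgroup_axioms)
  ultimately show ?thesis by blast
qed

end

theorem theorem1p2:
  fixes G :: "('a, 'b) monoid_scheme"
    and K :: "('k, 'm) ring_scheme"
    and V :: "('k, 'v, 'n) module_scheme"
    and \<rho> :: "'a \<Rightarrow> 'v \<Rightarrow> 'v"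
  assumes "group G"
    and "\<And>N. minimal_normal N G \<Longrightarrow> N \<subseteq> torsion_socle G \<Longrightarrow> finite (rcosets\<^bsub>G\<^esub> (centralizer G N))"
    and "field K"
    and "faithful_rep G K V \<rho>"
    and "irreducible_rep G K V \<rho>"
  shows "ring_char K \<notin> torsion_primes G \<and>
    (\<exists>S. subgroup S (G\<lparr>carrier := torsion_socle G\<rparr>) \<and>
         locally_cyclic ((G\<lparr>carrier := torsion_socle G\<rparr>) Mod S) \<and>
         normal_core G S = {\<one>\<^bsub>G\<^esub>})"
proof -
  interpret group G by fact
  interpret faithful_irreducible_with_abelian_normal G K V \<rho> "torsion_socle G"
    using assms(4,5) torsion_socle_normal torsion_socle_commute
    by (rule faithful_irreducible_with_abelian_normal.intro)
  have fin: "finite (conjugates G x)" if "x \<in> torsion_socle G" for x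
    using assms(2) that by (rule torsion_socle_finite_conjugates)
  have "ring_char K \<notin> torsion_primes G"
    using p_part_trivial_at_characteristic[OF _ K.ring_char_prime_imp fin]
    by (auto simp: torsion_primes_def)
  then show ?thesis
    using ex_locally_cyclic_quotient_core_free[OF torsion_socle_torsion fin] by blast
qed

end
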